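(* Let $\mathbf{L}=\langle L,\leq\rangle$ be a complete lattice, $M\subseteq L$, and $S$ an $L$-parameterization. Then $C_M$ is an $\mathbf{S}'$-closure operator, where $S'$ is the monoid generated by $S$; i.e., for all $a,b\in L$ and $\langle f,h\rangle\in S'$: $a\leq C_M(a)$; $a\leq b$ implies $C_M(a)\leq C_M(b)$; and $C_M(h(C_M(a)))\leq h(C_M(a))$.
   Context: An isotone Galois connection in $\mathbf{L}$ is a pair $\langle f,h\rangle$ of maps $L\to L$ with $f(a)\leq b$ iff $a\leq h(b)$; composition $\langle f_1,h_1\rangle\circ\langle f_2,h_2\rangle=\langle f_1f_2,h_2h_1\rangle$. An $L$-parameterization is a set $S$ of isotone Galois connections containing $\langle\mathrm{id},\mathrm{id}\rangle$. The monoid generated by $S$ is the set $S'$ of all finite compositions $\langle f_1,h_1\rangle\circ\cdots\circ\langle f_n,h_n\rangle$ of elements of $S$. For $a,b\in L$, $M\models a\Rightarrow b$ means: for all $m\in M$ and all $\langle f,h\rangle\in S'$, $f(a)\leq m$ implies $f(b)\leq m$. $C_M(a)=\bigvee\{b\in L;\ M\models a\Rightarrow b\}$. *)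

theory Defs
  imports Main
begin

definition isotone_galois :: "('a::order \<Rightarrow> 'a) \<times> ('a \<Rightarrow> 'a) \<Rightarrow> bool" where
  "isotone_galois = (\<lambda>(f, h). \<forall>a b. f a \<le> b \<longleftrightarrow> a \<le> h b)"

definition gc_comp ::
  "('a \<Rightarrow> 'a) \<times> ('a \<Rightarrow> 'a) \<Rightarrow> ('a \<Rightarrow> 'a) \<times> ('a \<Rightarrow> 'a) \<Rightarrow> ('a \<Rightarrow> 'a) \<times> ('a \<Rightarrow> 'a)" where
  "gc_comp = (\<lambda>(f\<^sub>1, h\<^sub>1) (f\<^sub>2, h\<^sub>2). (f\<^sub>1 \<circ> f\<^sub>2, h\<^sub>2 \<circ> h\<^sub>1))"

definition L_parameterization :: "(('a::order \<Rightarrow> 'a) \<times> ('a \<Rightarrow> 'a)) set \<Rightarrow> bool" where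
  "L_parameterization S \<longleftrightarrow> (\<forall>p\<in>S. isotone_galois p) \<and> (id, id) \<in> S"

text \<open>The empty composition is the identity pair, which an \<open>L\<close>-parameterization contains anyway.\<close>

definition generated_monoid ::
  "(('a \<Rightarrow> 'a) \<times> ('a \<Rightarrow> 'a)) set \<Rightarrow> (('a \<Rightarrow> 'a) \<times> ('a \<Rightarrow> 'a)) set" where
  "generated_monoid S = {foldr gc_comp ps (id, id) | ps. set ps \<subseteq> S}"

definition models_impl ::
  "(('a::order \<Rightarrow> 'a) \<times> ('a \<Rightarrow> 'a)) set \<Rightarrow> 'a set \<Rightarrow> 'a \<Rightarrow> 'a \<Rightarrow> bool" where
  "models_impl S M a b \<longleftrightarrow>
     (\<forall>m\<in>M. \<forall>(f, h)\<in>generated_monoid S. f a \<le> m \<longrightarrow> f b \<le> m)"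

definition model_closure ::
  "(('a::complete_lattice \<Rightarrow> 'a) \<times> ('a \<Rightarrow> 'a)) set \<Rightarrow> 'a set \<Rightarrow> 'a \<Rightarrow> 'a" where
  "model_closure S M a = Sup {b. models_impl S M a b}"

definition param_closure_operator ::
  "(('a::order \<Rightarrow> 'a) \<times> ('a \<Rightarrow> 'a)) set \<Rightarrow> ('a \<Rightarrow> 'a) \<Rightarrow> bool" where
  "param_closure_operator T C \<longleftrightarrow>
     (\<forall>a. a \<le> C a) \<and>
     (\<forall>a b. a \<le> b \<longrightarrow> C a \<le> C b) \<and>
     (\<forall>a. \<forall>(f, h)\<in>T. C (h (C a)) \<le> h (C a))"

end

theory Submission
  imports Defs
begin

text \<open>
  Each lower adjoint \<open>f\<close> in the generated monoid satisfies \<open>f b \<le> m \<longleftrightarrow> b \<le> h m\<close>, so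
  the valid consequences of \<open>a\<close> are closed under suprema and \<open>C\<^sub>M a\<close> is itself the largest of
  them. For the third closure axiom, put \<open>c = h (C\<^sub>M a)\<close>. By adjointness it suffices that
  \<open>f (C\<^sub>M c)\<close> is a consequence of \<open>a\<close>: if \<open>g a \<le> m\<close>, then \<open>g (f c) \<le> g (C\<^sub>M a) \<le> m\<close>, and validity
  of \<open>c \<Rightarrow> C\<^sub>M c\<close> at the composite \<open>g \<circ> f\<close> yields \<open>g (f (C\<^sub>M c)) \<le> m\<close>.
\<close>

lemma isotone_galois_comp:
  "isotone_galois p \<Longrightarrow> isotone_galois q \<Longrightarrow> isotone_galois (gc_comp p q)"
  by (auto simp: isotone_galois_def gc_comp_def split: prod.splits)

lemma isotone_galois_mono:
  assumes "isotone_galois (f, h)" "a \<le> b"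
  shows "f a \<le> f b"
proof -
  have adj: "f x \<le> y \<longleftrightarrow> x \<le> h y" for x y
    using assms(1) by (simp add: isotone_galois_def)
  \<comment> \<open>The unit of the adjunction; \<open>a \<le> h (f b)\<close> follows and
    transposes to the goal.\<close>
  have "b \<le> h (f b)"
    using adj by blast
  then show ?thesis
    using assms(2) adj order_trans by blast
qed

lemma gc_comp_assoc: "gc_comp (gc_comp p q) r = gc_comp p (gc_comp q r)"
  by (simp add: gc_comp_def comp_assoc split: prod.splits)

text \<open>Concatenating lists of generators multiplies the elements they represent, since
  \<open>gc_comp\<close> is associative with left unit \<open>(id, id)\<close>; hence closure of the
  monoid under composition.\<close>

lemma foldr_gc_comp_append:
  "foldr gc_comp (ps @ qs) (id, id) =
     gc_comp (foldr gc_comp ps (id, id)) (foldr gc_comp qs (id, id))"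
proof (induction ps)
  case Nil
  show ?case by (simp add: gc_comp_def comp_def split: prod.splits)
next
  case (Cons p ps)
  then show ?case by (simp add: gc_comp_assoc)
qed

lemma generated_monoid_comp:
  assumes "p \<in> generated_monoid S" "q \<in> generated_monoid S"
  shows "gc_comp p q \<in> generated_monoid S"
proof -
  obtain ps qs where "set ps \<subseteq> S" "p = foldr gc_comp ps (id, id)"
      and "set qs \<subseteq> S" "q = foldr gc_comp qs (id, id)"
    using assms unfolding generated_monoid_def by blast
  then have "set (ps @ qs) \<subseteq> S" "gc_comp p q = foldr gc_comp (ps @ qs) (id, id)"
    by (simp_all only: foldr_gc_comp_append set_append Un_least)
  then show ?thesis
    unfolding generated_monoid_def by blast
qed

lemma isotone_galois_generated_monoid:
  assumes "\<forall>p\<in>S. isotone_galois p" "p \<in> generated_monoid S"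
  shows "isotone_galois p"
proof -
  have "isotone_galois (foldr gc_comp ps (id, id))" if "set ps \<subseteq> S" for ps
    using that
  proof (induction ps)
    case Nil
    show ?case by (simp add: isotone_galois_def)
  next
    case (Cons p ps)
    then show ?case using assms(1) by (simp add: isotone_galois_comp)
  qed
  then show ?thesis
    using assms(2) unfolding generated_monoid_def by blast
qed

text \<open>The bound \<open>h m\<close> on a consequence \<open>b\<close> of \<open>a\<close> does
  not depend on \<open>b\<close>, so it also bounds the supremum.\<close>

lemma models_impl_model_closure:
  assumes "\<forall>p\<in>S. isotone_galois p"
  shows "models_impl S M a (model_closure S M a)"
  unfolding models_impl_def
proof (clarify)
  fix m f h
  assume m: "m \<in> M" and fh: "(f, h) \<in> generated_monoid S" and le: "f a \<le> m"
  have adj: "f x \<le> y \<longleftrightarrow> x \<le> h y" for x y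
    using isotone_galois_generated_monoid[OF assms fh] by (simp add: isotone_galois_def)
  have "b \<le> h m" if "models_impl S M a b" for b
    using that m fh le adj unfolding models_impl_def by blast
  then have "model_closure S M a \<le> h m"
    unfolding model_closure_def by (auto intro: Sup_least)
  then show "f (model_closure S M a) \<le> m"
    by (simp add: adj)
qed

lemma model_closure_upper: "models_impl S M a b \<Longrightarrow> b \<le> model_closure S M a"
  unfolding model_closure_def by (simp add: Sup_upper)

text \<open>Lower adjoints are monotone, so \<open>f b \<le> m\<close> forces
  \<open>f a \<le> m\<close>, where the given implication applies.\<close>

lemma models_impl_mono_left:
  assumes "\<forall>p\<in>S. isotone_galois p" "a \<le> b" "models_impl S M a c"
  shows "models_impl S M b c"
  unfolding models_impl_def
proof (clarify)
  fix m f h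
  assume m: "m \<in> M" and fh: "(f, h) \<in> generated_monoid S" and le: "f b \<le> m"
  have "f a \<le> f b"
    by (rule isotone_galois_mono[OF isotone_galois_generated_monoid[OF assms(1) fh] assms(2)])
  also note le
  finally show "f c \<le> m"
    using assms(3) m fh unfolding models_impl_def by blast
qed

theorem theorem28:
  fixes S :: "(('a::complete_lattice \<Rightarrow> 'a) \<times> ('a \<Rightarrow> 'a)) set"
    and M :: "'a set"
  assumes "L_parameterization S"
  shows "param_closure_operator (generated_monoid S) (model_closure S M)"
  unfolding param_closure_operator_def
proof (intro conjI allI impI ballI; clarify?)
  have S: "\<forall>p\<in>S. isotone_galois p"
    using assms by (simp add: L_parameterization_def)
  show "a \<le> model_closure S M a" for a
    by (rule model_closure_upper) (auto simp: models_impl_def)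
  show "model_closure S M a \<le> model_closure S M b" if "a \<le> b" for a b
    \<comment> \<open>The closure of \<open>a\<close> is a consequence of \<open>a\<close>, hence of
      the larger \<open>b\<close>, hence below the closure of \<open>b\<close>.\<close>
    by (rule model_closure_upper models_impl_mono_left[OF S that] models_impl_model_closure[OF S])+
  fix a f h
  assume fh: "(f, h) \<in> generated_monoid S"
  define c where "c = h (model_closure S M a)"
  have adj: "f x \<le> y \<longleftrightarrow> x \<le> h y" for x y
    using isotone_galois_generated_monoid[OF S fh] by (simp add: isotone_galois_def)
  have "models_impl S M a (f (model_closure S M c))"
    unfolding models_impl_def
  proof (clarify)
    fix m g k
    assume m: "m \<in> M" and gk: "(g, k) \<in> generated_monoid S" and le: "g a \<le> m"
    \<comment> \<open>The counit \<open>f (h y) \<le> y\<close> at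
      \<open>y = model_closure S M a\<close>.\<close>
    have "f c \<le> model_closure S M a"
      by (simp add: adj c_def)
    then have "g (f c) \<le> g (model_closure S M a)"
      by (rule isotone_galois_mono[OF isotone_galois_generated_monoid[OF S gk]])
    also have "\<dots> \<le> m"
      using models_impl_model_closure[OF S] m gk le unfolding models_impl_def by blast
    finally have "(g \<circ> f) c \<le> m"
      by simp
    \<comment> \<open>Upper adjoints compose in reverse order, hence
      \<open>h \<circ> k\<close>.\<close>
    moreover have "(g \<circ> f, h \<circ> k) \<in> generated_monoid S"
      using generated_monoid_comp[OF gk fh] by (simp add: gc_comp_def)
    ultimately have "(g \<circ> f) (model_closure S M c) \<le> m"
      using models_impl_model_closure[OF S] m unfolding models_impl_def by blast
    then show "g (f (model_closure S M c)) \<le> m"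
      by simp
  qed
  then have "f (model_closure S M c) \<le> model_closure S M a"
    by (rule model_closure_upper)
  then show "model_closure S M (h (model_closure S M a)) \<le> h (model_closure S M a)"
    by (simp add: adj c_def)
qed

end
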